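(* For each $\alpha\in\mathbb{R}$ let $F_\alpha\subset(0,\infty)$ be such that $\bigcup_{\alpha\in\mathbb{R}}\{\alpha\}\times F_\alpha$ is a (Lebesgue) measurable subset of $\mathbb{R}^2$. Then there exists a set $E\subset\mathbb{R}^2$ such that for almost every $\alpha\in\mathbb{R}$ we have $$\Delta_{(\alpha,0)}(E)\supset F_\alpha\qquad\text{and}\qquad|\Delta_{(\alpha,0)}(E)\setminus F_\alpha|=0 .$$
   Context: For $E\subset\mathbb{R}^2$ and $y\in\mathbb{R}^2$ (not necessarily in $E$), the pinned distance set at $y$ is $\Delta_y(E)=\{|x-y|:x\in E\}$, where $|x-y|$ is Euclidean distance. $|\cdot|$ applied to a set is Lebesgue measure. *)

theory Defs
  imports "HOL-Analysis.Analysis"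
begin

text \<open>
  The plane is \<^typ>\<open>real \<times> real\<close>; its library norm and distance are the Euclidean ones.
\<close>

definition pinned_distance_set :: "real \<times> real \<Rightarrow> (real \<times> real) set \<Rightarrow> real set"
  where "pinned_distance_set y E = {dist x y | x. x \<in> E}"

end

theory Submission
  imports Defs
begin

text \<open>
  With \<open>s = t\<^sup>2 - \<alpha>\<^sup>2\<close> and \<open>(u, v) = (- 2 x, x\<^sup>2 + y\<^sup>2)\<close>, the point \<open>(x, y)\<close> lies at distance \<open>t\<close>
  from \<open>(\<alpha>, 0)\<close> iff the line \<open>s = v + \<alpha> u\<close> passes through \<open>(\<alpha>, s)\<close>. The theorem thus becomes a
  form of Davies's covering theorem: every plane set can be covered by lines, taken from an open set
  of admissible lines, whose union exceeds a given \<open>G\<^sub>\<delta>\<close> superset only by a null set. Here a line is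
  admissible if it lies above the parabola \<open>s = - \<alpha>\<^sup>2\<close>.

  The local step is a Venetian blind construction. Small pencils of lines with centres at abscissa
  \<open>a\<close> have small total section over abscissae near \<open>a\<close>. Replacing each pencil by many smaller ones
  with centres at abscissa \<open>a'\<close> keeps a fixed strip near \<open>\<alpha> = c\<close> covered and increases the total
  opening of the pencils by a factor of at most \<open>1 + \<bar>a - a'\<bar> / d\<close>. Hence along any path of abscissae
  avoiding the strip the opening stays bounded in terms of the length of the path, however fine the
  steps, and fine steps give small sections everywhere along the path.
\<close>

section \<open>Point-line duality and pencils of lines\<close>

definition shadow :: "real \<Rightarrow> real \<times> real \<Rightarrow> real"
  where "shadow \<alpha> e = snd e + \<alpha> * fst e"

definition line_union :: "(real \<times> real) set \<Rightarrow> (real \<times> real) set"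
  where "line_union E = {(\<alpha>, shadow \<alpha> e) | \<alpha> e. e \<in> E}"

text \<open>
  A pair \<open>(u, v)\<close> stands for the line \<open>s = v + \<alpha> u\<close>. Moving it in the direction \<open>(1, - a)\<close> rotates the
  line about its point at abscissa \<open>a\<close>.
\<close>

definition blinds :: "real \<Rightarrow> real \<Rightarrow> (real \<times> real) set \<Rightarrow> (real \<times> real) set"
  where "blinds a h Z = {(fst z + x, snd z - a * x) | z x. z \<in> Z \<and> \<bar>x\<bar> \<le> h}"

text \<open>\<open>L\<close> bounds the total half-opening of the pencils. Their number and their
  common half-opening stay hidden, because a refinement controls only the product. Openness of
  \<open>V\<close> leaves room for the finer pencils of the next move.\<close>

definition blinded :: "real \<Rightarrow> real \<Rightarrow> (real \<times> real) set \<Rightarrow> (real \<times> real) set \<Rightarrow> bool"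
  where "blinded a L Q V \<longleftrightarrow> open V \<and> (\<exists>Z h. finite Z \<and> 0 < h \<and> real (card Z) * h \<le> L \<and>
           blinds a h Z \<subseteq> V \<and> Q \<subseteq> line_union (blinds a h Z))"

lemma line_union_mono: "E \<subseteq> E' \<Longrightarrow> line_union E \<subseteq> line_union E'"
  by (auto simp: line_union_def)

lemma mem_line_union: "(\<alpha>, s) \<in> line_union E \<longleftrightarrow> s \<in> shadow \<alpha> ` E"
  by (auto simp: line_union_def)

lemma continuous_on_shadow [continuous_intros]:
  assumes "continuous_on S f" "continuous_on S g"
  shows "continuous_on S (\<lambda>x. shadow (f x) (g x))"
  unfolding shadow_def using assms by (intro continuous_intros)

lemma compact_line_union:
  assumes "compact C"
  shows "compact (line_union C \<inter> {-r..r} \<times> UNIV)"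
proof -
  have "line_union C \<inter> {-r..r} \<times> UNIV = (\<lambda>(\<alpha>, e). (\<alpha>, shadow \<alpha> e)) ` ({-r..r} \<times> C)"
    by (auto simp: line_union_def image_iff)
  moreover have "compact \<dots>"
    unfolding case_prod_unfold using assms
    by (intro compact_continuous_image continuous_intros compact_Times) auto
  ultimately show ?thesis
    by simp
qed

lemma compact_blinds:
  assumes "finite Z"
  shows "compact (blinds a h Z)"
proof -
  have "blinds a h Z = (\<lambda>y. (fst (fst y) + snd y, snd (fst y) - a * snd y)) ` (Z \<times> {-h..h})"
    by (force simp: blinds_def abs_le_iff)
  moreover have "compact \<dots>"
    using assms by (intro compact_continuous_image continuous_intros compact_Times)
      (auto intro: finite_imp_compact)
  ultimately show ?thesis
    by simp
qed

text \<open>Cut \<open>[-h, h]\<close> into \<open>n\<close> equal cells; the grid points are their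
  midpoints, so the midpoint of the cell of \<open>x\<close> is within half a cell. The right end
  \<open>x = h\<close> is treated apart because the floor would give the index
  \<open>n\<close>.\<close>

lemma midpoint_grid:
  fixes h x :: real and n :: nat
  assumes "\<bar>x\<bar> \<le> h" "0 < h" "0 < n"
  obtains j where "j < n" "\<bar>x - h * (2 * real j + 1 - n) / n\<bar> \<le> h / n"
proof (cases "x = h")
  case True
  have "\<bar>x - h * (2 * real (n - 1) + 1 - n) / n\<bar> \<le> h / n"
    using assms True by (simp add: of_nat_diff field_simps)
  with \<open>0 < n\<close> that[of "n - 1"] show ?thesis
    by simp
next
  case False
  define y where "y = (x + h) * n / (2 * h)"
  have y: "0 \<le> y" "y < n"
  proof -
    have "0 \<le> x + h"
      using assms by linarith
    then show "0 \<le> y"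
      using assms by (auto simp: y_def)
    have "x + h < 2 * h"
      using assms False by linarith
    then show "y < n"
      using assms by (simp add: y_def pos_divide_less_eq)
  qed
  have x: "x = h * (2 * y - n) / n"
    using assms by (simp add: y_def field_simps)
  have j: "real (nat \<lfloor>y\<rfloor>) \<le> y" "y \<le> real (nat \<lfloor>y\<rfloor>) + 1"
    using y by linarith+
  have "x - h * (2 * real (nat \<lfloor>y\<rfloor>) + 1 - n) / n = (h / n) * (2 * y - (2 * real (nat \<lfloor>y\<rfloor>) + 1))"
    using \<open>0 < n\<close> unfolding x by (simp add: field_simps)
  then have "\<bar>x - h * (2 * real (nat \<lfloor>y\<rfloor>) + 1 - n) / n\<bar> = (h / n) * \<bar>2 * y - (2 * real (nat \<lfloor>y\<rfloor>) + 1)\<bar>"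
    using assms by (simp add: abs_mult)
  also have "\<bar>2 * y - (2 * real (nat \<lfloor>y\<rfloor>) + 1)\<bar> \<le> 1"
    using j by linarith
  then have "(h / n) * \<bar>2 * y - (2 * real (nat \<lfloor>y\<rfloor>) + 1)\<bar> \<le> (h / n) * 1"
    using assms by (intro mult_left_mono) (assumption, simp)
  finally show ?thesis
    using that[of "nat \<lfloor>y\<rfloor>"] y by (simp add: nat_less_iff floor_less_iff)
qed

text \<open>Outer measure allows shadows to be estimated without proving them measurable.\<close>

lemma outer_measure_of_finite_cballs:
  fixes f :: "'a \<Rightarrow> real" and r :: real
  assumes "finite Z" "S \<subseteq> (\<Union>z\<in>Z. cball (f z) r)" "0 \<le> r"
  shows "outer_measure_of lborel S \<le> ennreal (card Z * (2 * r))"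
proof -
  have "outer_measure_of lborel S \<le> emeasure lborel (\<Union>z\<in>Z. cball (f z) r)"
    using assms by (subst outer_measure_of_eq[symmetric]) (auto intro!: outer_measure_of_mono)
  also have "\<dots> \<le> (\<Sum>z\<in>Z. emeasure lborel (cball (f z) r))"
    using assms by (intro emeasure_subadditive_finite) auto
  also have "\<dots> = (\<Sum>z\<in>Z. ennreal (2 * r))"
    using assms by (intro sum.cong) (auto simp: cball_eq_atLeastAtMost)
  also have "\<dots> = ennreal (card Z * (2 * r))"
    using assms by (simp add: ennreal_mult ennreal_of_nat_eq_real_of_nat)
  finally show ?thesis .
qed

section \<open>Moving and sweeping the centres of the pencils\<close>

lemma blinded_mono:
  assumes "blinded a L Q V" "L \<le> L'"
  shows "blinded a L' Q V"
proof -
  obtain Z h where "finite Z" "0 < h" "real (card Z) * h \<le> L" "blinds a h Z \<subseteq> V"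
      "Q \<subseteq> line_union (blinds a h Z)" "open V"
    using assms(1) unfolding blinded_def by blast
  moreover from this have "real (card Z) * h \<le> L'"
    using assms(2) by linarith
  ultimately show ?thesis
    unfolding blinded_def by blast
qed

text \<open>Each pencil is cut into \<open>n\<close> short pieces, and each piece is replaced by a
  pencil centred at abscissa \<open>a'\<close>. Matching heights over \<alpha> scales the
  half-opening by \<open>\<bar>\<alpha> - a\<bar> / \<bar>\<alpha> - a'\<bar>\<close>, at most
  \<open>1 + \<bar>a - a'\<bar> / d\<close> since \<open>a'\<close> is at distance at least
  \<open>d\<close> from the strip. The new pencils are thin over abscissae near \<open>a'\<close>,
  and \<open>V\<close> is a small neighbourhood of them.\<close>

lemma blinded_move:
  assumes bl: "blinded a L Q U" and d: "0 < d" and Q: "Q \<subseteq> {c-d..c+d} \<times> UNIV"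
    and a': "2 * d \<le> \<bar>a' - c\<bar>" and \<sigma>: "0 \<le> \<sigma>" and b: "0 < b"
  shows "\<exists>V\<subseteq>U. blinded a' (L * (1 + \<bar>a - a'\<bar> / d)) Q V \<and>
    (\<forall>\<alpha>. \<bar>\<alpha> - a'\<bar> \<le> \<sigma> \<longrightarrow>
       outer_measure_of lborel (shadow \<alpha> ` V) \<le> ennreal (2 * \<sigma> * (L * (1 + \<bar>a - a'\<bar> / d)) + b))"
proof -
  obtain Z h where Z: "finite Z" "0 < h" "real (card Z) * h \<le> L" "blinds a h Z \<subseteq> U"
      "Q \<subseteq> line_union (blinds a h Z)" and U: "open U"
    using bl by (auto simp: blinded_def)
  define r where "r = \<bar>a - a'\<bar> / d"
  have r: "0 \<le> r"
    using d by (simp add: r_def)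
  obtain \<epsilon> where \<epsilon>: "0 < \<epsilon>" "(\<Union>x\<in>blinds a h Z. ball x \<epsilon>) \<subseteq> U"
    using compact_subset_open_imp_ball_epsilon_subset[OF compact_blinds[OF Z(1)] U Z(4)] by metis
  \<comment> \<open>So large that rotating a line by the new half-opening \<open>h'\<close> moves
    its dual point by less than \<epsilon>; the new pencils then stay in \<open>U\<close>.\<close>
  obtain n where n: "h * (1 + r) * (1 + \<bar>a'\<bar>) / \<epsilon> < real n"
    using reals_Archimedean2 by blast
  have n0: "0 < n"
  proof (rule ccontr)
    assume "\<not> 0 < n"
    moreover have "0 \<le> h * (1 + r) * (1 + \<bar>a'\<bar>) / \<epsilon>"
      using \<epsilon> r Z by (intro divide_nonneg_pos mult_nonneg_nonneg) auto
    ultimately show False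
      using n by simp
  qed
  define h' where "h' = h / n * (1 + r)"
  have h': "0 < h'" "h' * (1 + \<bar>a'\<bar>) < \<epsilon>"
    using Z n0 r n \<epsilon> by (auto simp: h'_def field_simps intro: add_pos_nonneg)
  define g where "g j = h * (2 * real j + 1 - n) / n" for j
  have g: "\<bar>g j\<bar> \<le> h" if "j < n" for j
  proof -
    have "\<bar>g j\<bar> = h * (\<bar>2 * real j + 1 - n\<bar> / n)"
      using Z by (simp add: g_def abs_mult)
    also have "\<dots> \<le> h * 1"
      using that Z n0 by (intro mult_left_mono) (auto simp: divide_simps)
    finally show ?thesis by simp
  qed
  define Z' where "Z' = (\<lambda>(z, j). (fst z + g j, snd z - a * g j)) ` (Z \<times> {..<n})"
  have Z': "finite Z'" "Z' \<subseteq> blinds a h Z"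
  proof -
    show "finite Z'"
      using Z(1) by (simp add: Z'_def)
    show "Z' \<subseteq> blinds a h Z"
    proof
      fix e assume "e \<in> Z'"
      then obtain z j where "z \<in> Z" "j < n" "e = (fst z + g j, snd z - a * g j)"
        by (auto simp: Z'_def)
      then show "e \<in> blinds a h Z"
        unfolding blinds_def using g[of j] by blast
    qed
  qed
  have "card Z' \<le> card Z * n"
    using card_image_le[of "Z \<times> {..<n}"] Z(1) by (simp add: Z'_def card_cartesian_product)
  then have "real (card Z') * h' \<le> real (card Z * n) * h'"
    using h' by (intro mult_right_mono) (auto simp del: of_nat_mult)
  also have "\<dots> = real (card Z) * h * (1 + r)"
    using n0 by (simp add: h'_def)
  also have "\<dots> \<le> L * (1 + r)"
    using Z r by (intro mult_right_mono) auto
  finally have cardZ': "real (card Z') * h' \<le> L * (1 + r)" .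
  have bU: "blinds a' h' Z' \<subseteq> U"
  proof
    fix e assume "e \<in> blinds a' h' Z'"
    then obtain z x where zx: "z \<in> Z'" "\<bar>x\<bar> \<le> h'" "e = (fst z + x, snd z - a' * x)"
      unfolding blinds_def by blast
    have "dist z e = norm (- x, a' * x)"
      by (cases z) (auto simp: zx dist_norm)
    also have "\<dots> \<le> norm (- x) + norm (a' * x)"
      by (rule norm_Pair_le)
    also have "\<dots> = \<bar>x\<bar> * (1 + \<bar>a'\<bar>)"
      by (simp add: abs_mult algebra_simps)
    also have "\<dots> \<le> h' * (1 + \<bar>a'\<bar>)"
      using zx by (intro mult_right_mono) auto
    also have "\<dots> < \<epsilon>"
      by (rule h')
    finally have "e \<in> ball z \<epsilon>"
      by simp
    then show "e \<in> U"
      using \<epsilon>(2) Z'(2) zx(1) by blast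
  qed
  have cov: "Q \<subseteq> line_union (blinds a' h' Z')"
  proof safe
    fix \<alpha> s assume q: "(\<alpha>, s) \<in> Q"
    then obtain z x where zx: "z \<in> Z" "\<bar>x\<bar> \<le> h" "s = shadow \<alpha> (fst z + x, snd z - a * x)"
      using subsetD[OF Z(5) q] unfolding mem_line_union blinds_def by blast
    obtain j where j: "j < n" "\<bar>x - g j\<bar> \<le> h / n"
      unfolding g_def using midpoint_grid[OF zx(2) Z(2) n0] by metis
    have \<alpha>: "\<bar>\<alpha> - c\<bar> \<le> d"
      using q Q by (auto simp: abs_le_iff)
    then have \<alpha>a': "d \<le> \<bar>\<alpha> - a'\<bar>"
      using a' by linarith
    text \<open>The new pencil has to reach, over \<open>\<alpha>\<close>, the same height as the old one.\<close>
    define x' where "x' = (x - g j) * ((\<alpha> - a) / (\<alpha> - a'))"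
    have "\<bar>\<alpha> - a\<bar> / \<bar>\<alpha> - a'\<bar> \<le> (\<bar>\<alpha> - a'\<bar> + \<bar>a - a'\<bar>) / \<bar>\<alpha> - a'\<bar>"
      by (intro divide_right_mono) auto
    also have "\<dots> = 1 + \<bar>a - a'\<bar> / \<bar>\<alpha> - a'\<bar>"
      using \<alpha>a' d by (simp add: add_divide_distrib)
    also have "\<dots> \<le> 1 + r"
      unfolding r_def using \<alpha>a' d by (intro add_left_mono divide_left_mono) auto
    finally have "\<bar>x'\<bar> \<le> h / n * (1 + r)"
      unfolding x'_def abs_mult using j Z by (intro mult_mono) (auto simp: abs_divide)
    moreover have "s = shadow \<alpha> (fst z + g j + x', snd z - a * g j - a' * x')"
    proof -
      have "x' * (\<alpha> - a') = (x - g j) * (\<alpha> - a)"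
        using \<alpha>a' d by (simp add: x'_def)
      then show ?thesis
        by (simp add: zx shadow_def algebra_simps)
    qed
    ultimately show "(\<alpha>, s) \<in> line_union (blinds a' h' Z')"
      unfolding mem_line_union h'_def
    proof (intro image_eqI)
      have "(fst z + g j, snd z - a * g j) \<in> Z'"
        unfolding Z'_def using zx j by (intro image_eqI[of _ _ "(z, j)"]) auto
      then show "(fst z + g j + x', snd z - a * g j - a' * x') \<in> blinds a' (h / n * (1 + r)) Z'"
        unfolding blinds_def using \<open>\<bar>x'\<bar> \<le> _\<close> by force
    qed
  qed
  \<comment> \<open>The slack around all pencils together contributes at most \<open>b\<close>. The
    \<open>+ 1\<close> keeps the denominator positive when \<open>Z'\<close> is empty.\<close>
  define \<eta> where "\<eta> = b / (2 * (card Z' + 1) * (1 + \<sigma>))"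
  have \<eta>: "0 < \<eta>" 
    using b \<sigma> by (auto simp: \<eta>_def intro!: divide_pos_pos)
  have \<eta>': "card Z' * (2 * (\<eta> * (1 + \<sigma>))) \<le> b"
  proof -
    have "card Z' * (2 * (\<eta> * (1 + \<sigma>))) \<le> (card Z' + 1) * (2 * (\<eta> * (1 + \<sigma>)))"
      using \<eta> \<sigma> by (intro mult_right_mono) auto
    also have "\<dots> = b"
      using \<sigma> by (simp add: \<eta>_def divide_simps)
    finally show ?thesis .
  qed
  \<comment> \<open>Thin parallelograms around the new segments, in the coordinates slope and height
    over \<open>a'\<close>. A shadow over \<alpha> changes by the height difference plus
    \<open>\<alpha> - a'\<close> times the slope difference, so both bounds enter the
    section.\<close>
  define V where
    "V = U \<inter> (\<Union>z\<in>Z'. {e. \<bar>fst e - fst z\<bar> < h' + \<eta> \<and> \<bar>shadow a' e - shadow a' z\<bar> < \<eta>})"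
  show ?thesis
  proof (intro exI[of _ V] conjI allI impI)
    show "V \<subseteq> U"
      by (auto simp: V_def)
    have "open V"
      unfolding V_def using U
      by (intro open_Int open_UN ballI open_Collect_conj open_Collect_less continuous_intros) auto
    moreover have "blinds a' h' Z' \<subseteq> V"
    proof
      fix e assume e: "e \<in> blinds a' h' Z'"
      then obtain z x where zx: "z \<in> Z'" "\<bar>x\<bar> \<le> h'" "e = (fst z + x, snd z - a' * x)"
        unfolding blinds_def by blast
      then have "\<bar>fst e - fst z\<bar> < h' + \<eta>" "\<bar>shadow a' e - shadow a' z\<bar> < \<eta>"
        using \<eta> by (auto simp: shadow_def algebra_simps)
      with e zx(1) bU show "e \<in> V"
        unfolding V_def by blast
    qed
    ultimately show "blinded a' (L * (1 + \<bar>a - a'\<bar> / d)) Q V"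
      unfolding blinded_def using Z' h' cov cardZ' r_def by blast
    fix \<alpha> assume \<alpha>: "\<bar>\<alpha> - a'\<bar> \<le> \<sigma>"
    have "shadow \<alpha> ` V \<subseteq> (\<Union>z\<in>Z'. cball (shadow \<alpha> z) (\<eta> + \<sigma> * (h' + \<eta>)))"
    proof safe
      fix e1 e2 assume "(e1, e2) \<in> V"
      then obtain z where z: "z \<in> Z'" "\<bar>e1 - fst z\<bar> < h' + \<eta>" "\<bar>shadow a' (e1, e2) - shadow a' z\<bar> < \<eta>"
        unfolding V_def by auto
      have "\<bar>(\<alpha> - a') * (e1 - fst z)\<bar> \<le> \<sigma> * (h' + \<eta>)"
        unfolding abs_mult using z \<alpha> \<sigma> by (intro mult_mono) auto
      moreover have "shadow \<alpha> (e1, e2) - shadow \<alpha> z =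
          shadow a' (e1, e2) - shadow a' z + (\<alpha> - a') * (e1 - fst z)"
        by (simp add: shadow_def algebra_simps)
      ultimately have "dist (shadow \<alpha> z) (shadow \<alpha> (e1, e2)) \<le> \<eta> + \<sigma> * (h' + \<eta>)"
        using z(3) unfolding dist_real_def by linarith
      with z(1) show "shadow \<alpha> (e1, e2) \<in> (\<Union>z\<in>Z'. cball (shadow \<alpha> z) (\<eta> + \<sigma> * (h' + \<eta>)))"
        by auto
    qed
    then have "outer_measure_of lborel (shadow \<alpha> ` V) \<le> ennreal (card Z' * (2 * (\<eta> + \<sigma> * (h' + \<eta>))))"
      using \<eta> \<sigma> h' Z' by (intro outer_measure_of_finite_cballs) auto
    also have "card Z' * (2 * (\<eta> + \<sigma> * (h' + \<eta>))) =
        2 * \<sigma> * (card Z' * h') + card Z' * (2 * (\<eta> * (1 + \<sigma>)))"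
      by (simp add: algebra_simps)
    also have "\<dots> \<le> 2 * \<sigma> * (L * (1 + r)) + b"
      using cardZ' \<eta>' \<sigma> by (intro add_mono mult_left_mono) auto
    finally show "outer_measure_of lborel (shadow \<alpha> ` V)
        \<le> ennreal (2 * \<sigma> * (L * (1 + \<bar>a - a'\<bar> / d)) + b)"
      unfolding r_def by (simp add: ennreal_leI)
  qed
qed

text \<open>Each of the \<open>k\<close> moves costs a factor \<open>1 + \<sigma> / d\<close>, at
  most \<open>exp (\<sigma> / d)\<close>, so the total cost depends only on the length
  \<open>k * \<sigma>\<close>. Bounds over abscissae already swept persist because the sets shrink;
  the others are within \<sigma> of the new centre. The interval omits \<open>a\<close>, since
  nothing is known about the shadows of \<open>U\<close> itself.\<close>

lemma blinded_sweep:
  fixes a \<sigma> :: real and k :: nat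
  assumes bl: "blinded a L Q U" and d: "0 < d" and Q: "Q \<subseteq> {c-d..c+d} \<times> UNIV"
    and away: "\<And>\<alpha>. a \<le> \<alpha> \<Longrightarrow> \<alpha> \<le> a + k * \<sigma> \<Longrightarrow> 2 * d \<le> \<bar>\<alpha> - c\<bar>"
    and \<sigma>: "0 \<le> \<sigma>" and b: "0 < b" and L: "0 \<le> L"
  shows "\<exists>V\<subseteq>U. blinded (a + k * \<sigma>) (L * exp (k * \<sigma> / d)) Q V \<and>
    (\<forall>\<alpha>\<in>{a<..a + k * \<sigma>}.
       outer_measure_of lborel (shadow \<alpha> ` V) \<le> ennreal (2 * \<sigma> * (L * exp (k * \<sigma> / d)) + b))"
  using away
proof (induction k)
  case 0
  then show ?case
    using bl by auto
next
  case (Suc k)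
  have "a + k * \<sigma> \<le> a + Suc k * \<sigma>"
    using \<sigma> by (simp add: algebra_simps)
  then have "2 * d \<le> \<bar>\<alpha> - c\<bar>" if "a \<le> \<alpha>" "\<alpha> \<le> a + k * \<sigma>" for \<alpha>
    using that by (intro Suc.prems) linarith+
  from Suc.IH[OF this] obtain V where V: "V \<subseteq> U" "blinded (a + k * \<sigma>) (L * exp (k * \<sigma> / d)) Q V"
    "\<forall>\<alpha>\<in>{a<..a + k * \<sigma>}.
       outer_measure_of lborel (shadow \<alpha> ` V) \<le> ennreal (2 * \<sigma> * (L * exp (k * \<sigma> / d)) + b)"
    by blast
  have "a \<le> a + Suc k * \<sigma>"
    using \<sigma> by simp
  from Suc.prems[OF this order_refl] obtain V' where V': "V' \<subseteq> V"
    "blinded (a + Suc k * \<sigma>) (L * exp (k * \<sigma> / d) * (1 + \<bar>a + k * \<sigma> - (a + Suc k * \<sigma>)\<bar> / d)) Q V'"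
    "\<forall>\<alpha>. \<bar>\<alpha> - (a + Suc k * \<sigma>)\<bar> \<le> \<sigma> \<longrightarrow> outer_measure_of lborel (shadow \<alpha> ` V') \<le>
       ennreal (2 * \<sigma> * (L * exp (k * \<sigma> / d) * (1 + \<bar>a + k * \<sigma> - (a + Suc k * \<sigma>)\<bar> / d)) + b)"
    using blinded_move[OF V(2) d Q _ \<sigma> b] by blast
  have step: "\<bar>a + k * \<sigma> - (a + Suc k * \<sigma>)\<bar> = \<sigma>"
    using \<sigma> by (simp add: algebra_simps)
  have "L * exp (k * \<sigma> / d) * (1 + \<sigma> / d) \<le> L * exp (k * \<sigma> / d) * exp (\<sigma> / d)"
    using L by (intro mult_left_mono exp_ge_add_one_self) auto
  also have "\<dots> = L * exp (Suc k * \<sigma> / d)"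
    by (simp add: add_divide_distrib distrib_right exp_add algebra_simps)
  finally have le: "L * exp (k * \<sigma> / d) * (1 + \<sigma> / d) \<le> L * exp (Suc k * \<sigma> / d)" .
  have le': "L * exp (k * \<sigma> / d) \<le> L * exp (Suc k * \<sigma> / d)"
    using \<sigma> L d by (intro mult_left_mono) (auto simp: divide_simps algebra_simps)
  have "outer_measure_of lborel (shadow \<alpha> ` V') \<le> ennreal (2 * \<sigma> * (L * exp (Suc k * \<sigma> / d)) + b)"
    if "\<alpha> \<in> {a<..a + Suc k * \<sigma>}" for \<alpha>
  proof (cases "\<alpha> \<le> a + k * \<sigma>")
    case True
    have "outer_measure_of lborel (shadow \<alpha> ` V') \<le> outer_measure_of lborel (shadow \<alpha> ` V)"
      using V' by (intro outer_measure_of_mono image_mono)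
    also have "\<dots> \<le> ennreal (2 * \<sigma> * (L * exp (k * \<sigma> / d)) + b)"
      using bspec[OF V(3), of \<alpha>] that True by simp
    also have "\<dots> \<le> ennreal (2 * \<sigma> * (L * exp (Suc k * \<sigma> / d)) + b)"
      using \<sigma> le' by (intro ennreal_leI add_right_mono mult_left_mono[OF le']) simp
    finally show ?thesis .
  next
    case False
    then have "\<bar>\<alpha> - (a + Suc k * \<sigma>)\<bar> \<le> \<sigma>"
      using that by (auto simp: algebra_simps)
    from V'(3)[rule_format, OF this]
    have "outer_measure_of lborel (shadow \<alpha> ` V') \<le> ennreal (2 * \<sigma> * (L * exp (k * \<sigma> / d) * (1 + \<sigma> / d)) + b)"
      unfolding step .
    also have "\<dots> \<le> ennreal (2 * \<sigma> * (L * exp (Suc k * \<sigma> / d)) + b)"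
      using \<sigma> by (intro ennreal_leI add_right_mono mult_left_mono[OF le]) simp
    finally show ?thesis .
  qed
  moreover have "blinded (a + Suc k * \<sigma>) (L * exp (Suc k * \<sigma> / d)) Q V'"
    using V'(2) le unfolding step by (rule blinded_mono)
  ultimately show ?case
    using V V' by blast
qed

section \<open>The local covering statement\<close>

text \<open>Over abscissae near \<open>c\<close>, lines close to \<open>e0\<close> stay in
  \<open>G\<close>; over the rest of the window a sweep makes the sections small. \<open>Q\<close>
  is fixed before \<epsilon>, so that countably many such neighbourhoods can be selected first and
  given tolerances afterwards.\<close>

lemma local_davies:
  assumes W: "open W" "e0 \<in> W" and G: "open G" "(c, shadow c e0) \<in> G" and R: "0 \<le> R"
  obtains Q where "open Q" "(c, shadow c e0) \<in> Q"
    "\<And>\<epsilon>. 0 < \<epsilon> \<Longrightarrow> \<exists>C. compact C \<and> C \<subseteq> W \<and> Q \<subseteq> line_union (interior C) \<and>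
       emeasure lborel (line_union C \<inter> {-R..R} \<times> UNIV - G) \<le> ennreal \<epsilon>"
proof -
  have "open ((\<lambda>(\<alpha>, e). (\<alpha>, shadow \<alpha> e)) -` G)"
    unfolding case_prod_unfold by (intro open_vimage G continuous_intros)
  then obtain A B where AB: "open A" "open B" "c \<in> A" "e0 \<in> B"
      "A \<times> B \<subseteq> (\<lambda>(\<alpha>, e). (\<alpha>, shadow \<alpha> e)) -` G"
    using G(2) by (elim open_prod_elim[where x = "(c, e0)"]) auto
  obtain \<rho> where \<rho>: "0 < \<rho>" "ball c \<rho> \<subseteq> A"
    using AB openE by blast
  define d where "d = \<rho> / 4"
  have d: "0 < d"
    using \<rho> by (simp add: d_def)
  define U where "U = B \<inter> W"
  have U: "open U" "e0 \<in> U" "U \<subseteq> W"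
    using AB W by (auto simp: U_def)
  have near: "(\<alpha>, shadow \<alpha> e) \<in> G" if "\<bar>\<alpha> - c\<bar> \<le> 2 * d" "e \<in> U" for \<alpha> e
  proof -
    have "\<bar>c - \<alpha>\<bar> < \<rho>"
      using that(1) \<rho>(1) unfolding d_def by linarith
    then have "\<alpha> \<in> A"
      using \<rho>(2) by (auto simp: dist_real_def)
    then show ?thesis
      using AB that by (auto simp: U_def)
  qed
  obtain r where r: "0 < r" "ball e0 r \<subseteq> U"
    using U openE by blast
  \<comment> \<open>The initial centre lies where \<open>near\<close> still applies, yet at distance
    at least \<open>d\<close> from the strip to be covered.\<close>
  define a where "a = c + 2 * d"
  define h where "h = r / (2 * (1 + \<bar>a\<bar>))"
  have h: "0 < h"
    using r by (auto simp: h_def intro!: divide_pos_pos)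
  have start: "blinds a h {e0} \<subseteq> U"
  proof
    fix e assume "e \<in> blinds a h {e0}"
    then obtain x where x: "\<bar>x\<bar> \<le> h" "e = (fst e0 + x, snd e0 - a * x)"
      unfolding blinds_def by blast
    have "dist e0 e = norm (- x, a * x)"
      by (cases e0) (auto simp: x dist_norm)
    also have "\<dots> \<le> norm (- x) + norm (a * x)"
      by (rule norm_Pair_le)
    also have "\<dots> = \<bar>x\<bar> * (1 + \<bar>a\<bar>)"
      by (simp add: abs_mult algebra_simps)
    also have "\<dots> \<le> h * (1 + \<bar>a\<bar>)"
      using x by (intro mult_right_mono) auto
    also have "\<dots> = r / 2"
      by (simp add: h_def divide_simps)
    also have "\<dots> < r"
      using r by simp
    finally show "e \<in> U"
      using r by auto
  qed
  \<comment> \<open>Over the strip the initial pencil, at distance at least \<open>d\<close> from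
    its centre, reaches every height within \<open>d * h\<close> of the line
    \<open>e0\<close>.\<close>
  define Q where "Q = {c-d<..<c+d} \<times> UNIV \<inter> {p. \<bar>snd p - shadow (fst p) e0\<bar> < d * h}"
  have Q: "open Q" "(c, shadow c e0) \<in> Q" "Q \<subseteq> {c-d..c+d} \<times> UNIV"
  proof -
    show "open Q"
      unfolding Q_def by (intro open_Int open_Times open_Collect_less continuous_intros) auto
  qed (use d h in \<open>auto simp: Q_def\<close>)
  have "Q \<subseteq> line_union (blinds a h {e0})"
  proof safe
    fix \<alpha> s assume q: "(\<alpha>, s) \<in> Q"
    then have \<alpha>: "d \<le> \<bar>\<alpha> - a\<bar>" and s: "\<bar>s - shadow \<alpha> e0\<bar> \<le> h * d"
      using d by (auto simp: Q_def a_def mult.commute)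
    define x where "x = (s - shadow \<alpha> e0) / (\<alpha> - a)"
    have "\<bar>x\<bar> = \<bar>s - shadow \<alpha> e0\<bar> / \<bar>\<alpha> - a\<bar>"
      by (simp add: x_def abs_divide)
    also have "\<dots> \<le> (h * d) / d"
      using \<alpha> s d h by (intro frac_le) auto
    finally have "\<bar>x\<bar> \<le> h"
      using d by simp
    moreover have "s = shadow \<alpha> (fst e0 + x, snd e0 - a * x)"
    proof -
      have "x * (\<alpha> - a) = s - shadow \<alpha> e0"
        using \<alpha> d by (auto simp: x_def)
      then show ?thesis
        by (simp add: shadow_def algebra_simps)
    qed
    ultimately show "(\<alpha>, s) \<in> line_union (blinds a h {e0})"
      unfolding mem_line_union blinds_def by blast
  qed
  then have bl0: "blinded a h Q U"
    unfolding blinded_def using U start h by (intro conjI exI[of _ "{e0}"] exI[of _ h]) auto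
  have "\<exists>C. compact C \<and> C \<subseteq> W \<and> Q \<subseteq> line_union (interior C) \<and>
       emeasure lborel (line_union C \<inter> {-R..R} \<times> UNIV - G) \<le> ennreal \<epsilon>" if \<epsilon>: "0 < \<epsilon>" for \<epsilon>
  proof -
    \<comment> \<open>The bound for a single section; the window has length \<open>2 * R\<close>,
      and the \<open>+ 1\<close> covers \<open>R = 0\<close>.\<close>
    define \<beta> where "\<beta> = \<epsilon> / (2 * R + 1)"
    have \<beta>: "0 < \<beta>" "\<beta> * (2 * R) \<le> \<epsilon>"
      using \<epsilon> R by (auto simp: \<beta>_def divide_simps)
    define R' where "R' = R + \<bar>c\<bar> + 2 * d + 1"
    define D where "D = R' - 2 * d"
    have R': "0 < R'" "2 * d \<le> R'" "0 < D"
      using R d by (auto simp: R'_def D_def)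
    \<comment> \<open>The bounds on the total opening after the right sweep, the jump and the left
      sweep.\<close>
    define L1 where "L1 = h * exp (D / d)"
    define L2 where "L2 = L1 * (1 + \<bar>c + R' - (c - R')\<bar> / d)"
    define L3 where "L3 = L2 * exp (D / d)"
    have L1: "0 \<le> L1"
      using h by (simp add: L1_def)
    have L12: "L1 * 1 \<le> L2"
      unfolding L2_def using L1 d by (intro mult_left_mono) auto
    with L1 have L2: "0 \<le> L2"
      by simp
    have L23: "L2 * 1 \<le> L3"
      unfolding L3_def using L2 R' d by (intro mult_left_mono) auto
    \<comment> \<open>With steps of size \<open>D / K\<close>, this makes
      \<open>2 * \<sigma> * L3\<close> at most \<open>\<beta> / 2\<close>.\<close>
    obtain K :: nat where K: "4 * D * L3 / \<beta> < K"
      using reals_Archimedean2 by blast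
    have "0 \<le> 4 * D * L3 / \<beta>"
      using R' L2 L23 \<beta> by auto
    with K have K0: "0 < real K"
      by linarith
    define \<sigma> where "\<sigma> = D / K"
    have \<sigma>: "0 \<le> \<sigma>" "K * \<sigma> = D"
      using K0 R' by (auto simp: \<sigma>_def)
    have \<sigma>L3: "2 * \<sigma> * L3 + \<beta> / 2 \<le> \<beta>"
      using K K0 \<beta> by (simp add: \<sigma>_def field_simps)
    have "2 * \<sigma> * L1 \<le> 2 * \<sigma> * L3"
      using L12 L23 \<sigma> by (intro mult_left_mono) auto
    with \<sigma>L3 have \<sigma>L1: "2 * \<sigma> * L1 + \<beta> / 2 \<le> \<beta>"
      by linarith
    text \<open>
      The centres sweep the part of the window to the right of \<open>c\<close>, jump to the left end of the window
      and sweep the part to the left of \<open>c\<close>. The bound \<open>L3\<close> on the opening does not depend on \<open>K\<close>.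
    \<close>
    have "2 * d \<le> \<bar>\<alpha> - c\<bar>" if "a \<le> \<alpha>" for \<alpha>
      using that by (simp add: a_def)
    then obtain V1 where V1: "V1 \<subseteq> U" "blinded (c + R') L1 Q V1"
      "\<forall>\<alpha>\<in>{c + 2 * d<..c + R'}. outer_measure_of lborel (shadow \<alpha> ` V1) \<le> ennreal (2 * \<sigma> * L1 + \<beta> / 2)"
      using blinded_sweep[OF bl0 d Q(3) _ \<sigma>(1), of K "\<beta> / 2"] \<beta>(1) h
      unfolding \<sigma>(2) L1_def[symmetric] by (auto simp: a_def D_def)
    have "2 * d \<le> \<bar>c - R' - c\<bar>"
      using R' by simp
    from blinded_move[OF V1(2) d Q(3) this \<sigma>(1) \<beta>(1), folded L2_def]
    obtain V2 where V2: "V2 \<subseteq> V1" "blinded (c - R') L2 Q V2"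
      by blast
    have "2 * d \<le> \<bar>\<alpha> - c\<bar>" if "\<alpha> \<le> c - R' + D" for \<alpha>
      using that by (simp add: D_def)
    then obtain V3 where V3: "V3 \<subseteq> V2" "blinded (c - 2 * d) L3 Q V3"
      "\<forall>\<alpha>\<in>{c - R'<..c - 2 * d}. outer_measure_of lborel (shadow \<alpha> ` V3) \<le> ennreal (2 * \<sigma> * L3 + \<beta> / 2)"
      using blinded_sweep[OF V2(2) d Q(3) _ \<sigma>(1), of K "\<beta> / 2"] \<beta>(1) L2
      unfolding \<sigma>(2) L3_def[symmetric] by (auto simp: D_def)
    have small: "outer_measure_of lborel (shadow \<alpha> ` V3) \<le> ennreal \<beta>"
      if "\<alpha> \<in> {-R..R}" "2 * d < \<bar>\<alpha> - c\<bar>" for \<alpha>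
    proof -
      have "\<bar>\<alpha>\<bar> \<le> R" "0 < \<bar>\<alpha> - c\<bar>"
        using that d by auto
      then have "\<alpha> \<in> {c + 2 * d<..c + R'} \<or> \<alpha> \<in> {c - R'<..c - 2 * d}"
        using that(2) d unfolding R'_def greaterThanAtMost_iff by linarith
      then show ?thesis
      proof
        assume 1: "\<alpha> \<in> {c + 2 * d<..c + R'}"
        have "outer_measure_of lborel (shadow \<alpha> ` V3) \<le> outer_measure_of lborel (shadow \<alpha> ` V1)"
          using V2 V3 by (intro outer_measure_of_mono image_mono) auto
        also have "\<dots> \<le> ennreal (2 * \<sigma> * L1 + \<beta> / 2)"
          using V1(3) 1 by blast
        also have "\<dots> \<le> ennreal \<beta>"
          using \<sigma>L1 by (rule ennreal_leI)
        finally show ?thesis .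
      next
        assume 2: "\<alpha> \<in> {c - R'<..c - 2 * d}"
        have "outer_measure_of lborel (shadow \<alpha> ` V3) \<le> ennreal (2 * \<sigma> * L3 + \<beta> / 2)"
          using V3(3) 2 by blast
        also have "\<dots> \<le> ennreal \<beta>"
          using \<sigma>L3 by (rule ennreal_leI)
        finally show ?thesis .
      qed
    qed
    obtain Z h' where Z: "finite Z" "blinds (c - 2 * d) h' Z \<subseteq> V3"
        "Q \<subseteq> line_union (blinds (c - 2 * d) h' Z)" and V3o: "open V3"
      using V3(2) unfolding blinded_def by blast
    define S where "S = blinds (c - 2 * d) h' Z"
    have S: "compact S" "S \<subseteq> V3" "S \<noteq> {}"
      using Z Q(2) compact_blinds[OF Z(1)] by (auto simp: S_def line_union_def)
    \<comment> \<open>A closed neighbourhood of the compact set \<open>S\<close> is compact and has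
      \<open>S\<close> in its interior. \<open>S\<close> must be nonempty, as \<open>infdist\<close>
      to the empty set is 0 everywhere.\<close>
    obtain \<eta> where \<eta>: "0 < \<eta>" "{e. infdist e S \<le> \<eta>} \<subseteq> V3"
      using compact_in_open_separated[OF S(3,1) V3o S(2)] by blast
    define C where "C = {e. infdist e S \<le> \<eta>}"
    have C: "compact C" "C \<subseteq> V3" "C \<subseteq> U"
      using compact_infdist_le[OF S(3,1) \<eta>(1)] \<eta>(2) V1(1) V2(1) V3(1) by (auto simp: C_def)
    have "open {e. infdist e S < \<eta>}"
      by (intro open_Collect_less continuous_intros)
    then have "{e. infdist e S < \<eta>} \<subseteq> interior C"
      by (intro interior_maximal) (auto simp: C_def)
    moreover have "S \<subseteq> {e. infdist e S < \<eta>}"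
      using \<eta>(1) by auto
    ultimately have SC: "S \<subseteq> interior C"
      by blast
    define X where "X = line_union C \<inter> {-R..R} \<times> UNIV - G"
    have X: "X \<in> sets (lborel \<Otimes>\<^sub>M lborel)"
      unfolding X_def lborel_prod using compact_line_union[OF C(1), of R] G(1)
      by (auto simp: borel_compact)
    have fibre: "emeasure lborel (Pair \<alpha> -` X) \<le> ennreal \<beta> * indicator {-R..R} \<alpha>" for \<alpha>
    proof (cases "\<alpha> \<in> {-R..R} \<and> 2 * d < \<bar>\<alpha> - c\<bar>")
      case True
      have "emeasure lborel (Pair \<alpha> -` X) = outer_measure_of lborel (Pair \<alpha> -` X)"
        using sets_Pair1[OF X] by simp
      also have "\<dots> \<le> outer_measure_of lborel (shadow \<alpha> ` V3)"
        using image_mono[OF C(2), of "shadow \<alpha>"]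
        by (intro outer_measure_of_mono) (auto simp: X_def mem_line_union)
      also have "\<dots> \<le> ennreal \<beta>"
        using True by (intro small) auto
      finally show ?thesis
        using True by simp
    next
      case False
      then have "Pair \<alpha> -` X = {}"
        using near[OF _ subsetD[OF C(3)]] by (auto simp: X_def mem_line_union not_less)
      then show ?thesis
        by simp
    qed
    have "emeasure lborel X = (\<integral>\<^sup>+\<alpha>. emeasure lborel (Pair \<alpha> -` X) \<partial>lborel)"
      unfolding lborel_prod[symmetric] by (rule lborel.emeasure_pair_measure_alt[OF X])
    also have "\<dots> \<le> (\<integral>\<^sup>+\<alpha>. ennreal \<beta> * indicator {-R..R} \<alpha> \<partial>lborel)"
      by (intro nn_integral_mono fibre)
    also have "\<dots> = ennreal (\<beta> * (2 * R))"
      using R \<beta> by (simp add: nn_integral_cmult_indicator ennreal_mult)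
    also have "\<dots> \<le> ennreal \<epsilon>"
      by (rule ennreal_leI) (rule \<beta>)
    finally have "emeasure lborel X \<le> ennreal \<epsilon>" .
    moreover have "Q \<subseteq> line_union (interior C)"
      using Z(3) line_union_mono[OF SC] by (auto simp: S_def)
    ultimately show ?thesis
      using C U unfolding X_def by blast
  qed
  with Q that show ?thesis
    by blast
qed

section \<open>One countable refinement of a cover by lines\<close>

lemma refine_cover:
  assumes cov: "\<And>p. p \<in> A \<Longrightarrow> p \<in> line_union (interior (U p))" and count: "countable (U ` A)"
    and G: "open G" "A \<subseteq> G" and \<epsilon>: "0 < \<epsilon>" and R: "0 \<le> R"
  shows "\<exists>U' T. (\<forall>p\<in>A. compact (U' p) \<and> U' p \<subseteq> U p \<and> p \<in> line_union (interior (U' p))) \<and>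
    countable (U' ` A) \<and> T \<in> sets lborel \<and> emeasure lborel T \<le> ennreal \<epsilon> \<and>
    (\<forall>p\<in>A. line_union (U' p) \<inter> {-R..R} \<times> UNIV - G \<subseteq> T)"
proof (cases "A = {}")
  case True
  then show ?thesis
    by (intro exI[of _ U] exI[of _ "{}"]) simp
next
  case False
  have "\<exists>Q. open Q \<and> p \<in> Q \<and> (\<forall>\<epsilon>>0. \<exists>C. compact C \<and> C \<subseteq> interior (U p) \<and> Q \<subseteq> line_union (interior C) \<and>
       emeasure lborel (line_union C \<inter> {-R..R} \<times> UNIV - G) \<le> ennreal \<epsilon>)" if p: "p \<in> A" for p
  proof -
    obtain \<alpha> e where e: "e \<in> interior (U p)" "p = (\<alpha>, shadow \<alpha> e)"
      using cov[OF p] by (auto simp: line_union_def)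
    then have "(\<alpha>, shadow \<alpha> e) \<in> G"
      using p G by auto
    from local_davies[OF open_interior e(1) G(1) this R] show ?thesis
      unfolding e(2) by metis
  qed
  then obtain Q where Q: "\<And>p. p \<in> A \<Longrightarrow> open (Q p)" "\<And>p. p \<in> A \<Longrightarrow> p \<in> Q p"
    "\<And>p \<epsilon>. p \<in> A \<Longrightarrow> 0 < \<epsilon> \<Longrightarrow> \<exists>C. compact C \<and> C \<subseteq> interior (U p) \<and> Q p \<subseteq> line_union (interior C) \<and>
       emeasure lborel (line_union C \<inter> {-R..R} \<times> UNIV - G) \<le> ennreal \<epsilon>"
    by metis
  \<comment> \<open>Lindelof is applied separately to each value \<open>B\<close> of
    \<open>U\<close>: the set chosen for \<open>q\<close> lies in \<open>U q\<close>, so it can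
    serve \<open>p\<close> only if \<open>U q = U p\<close>. Countably many values keep the
    selection countable.\<close>
  have subcover: "\<exists>P. countable P \<and> P \<subseteq> {p \<in> A. U p = B} \<and> {p \<in> A. U p = B} \<subseteq> (\<Union>q\<in>P. Q q)" for B
  proof -
    have "\<And>S. S \<in> Q ` {p \<in> A. U p = B} \<Longrightarrow> open S"
      using Q(1) by blast
    then obtain \<F> where \<F>: "\<F> \<subseteq> Q ` {p \<in> A. U p = B}" "countable \<F>"
        "\<Union>\<F> = \<Union>(Q ` {p \<in> A. U p = B})"
      by (rule Lindelof)
    then obtain P where "countable P" "P \<subseteq> {p \<in> A. U p = B}" "\<F> = Q ` P"
      using countable_subset_image[of \<F> Q "{p \<in> A. U p = B}"] by blast
    moreover have "{p \<in> A. U p = B} \<subseteq> \<Union>(Q ` {p \<in> A. U p = B})"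
      using Q(2) by blast
    ultimately show ?thesis
      using \<F>(3) by (intro exI[of _ P]) simp
  qed
  define P where "P B = (SOME P. countable P \<and> P \<subseteq> {p \<in> A. U p = B} \<and>
      {p \<in> A. U p = B} \<subseteq> (\<Union>q\<in>P. Q q))" for B
  have P: "countable (P B)" "P B \<subseteq> {p \<in> A. U p = B}" "{p \<in> A. U p = B} \<subseteq> (\<Union>q\<in>P B. Q q)" for B
    using someI_ex[OF subcover[of B]] unfolding P_def[symmetric] by simp_all
  define P' where "P' = (\<Union>B\<in>U ` A. P B)"
  have P': "countable P'" "P' \<subseteq> A"
    unfolding P'_def by (intro countable_UN count P(1)) (use P(2) in blast)
  have sel: "\<exists>q\<in>P'. U q = U p \<and> p \<in> Q q" if p: "p \<in> A" for p
  proof -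
    obtain q where "q \<in> P (U p)" "p \<in> Q q"
      using P(3)[of "U p"] p by auto
    then show ?thesis
      using P(2)[of "U p"] p unfolding P'_def by (intro bexI[of _ q]) auto
  qed
  with False have "P' \<noteq> {}"
    by blast
  define q where "q = from_nat_into P'"
  have q: "range q = P'"
    unfolding q_def by (rule range_from_nat_into) fact+
  \<comment> \<open>The selected points are now enumerated, and the tolerances sum to
    \<epsilon>.\<close>
  have "\<exists>C. compact C \<and> C \<subseteq> interior (U (q n)) \<and> Q (q n) \<subseteq> line_union (interior C) \<and>
       emeasure lborel (line_union C \<inter> {-R..R} \<times> UNIV - G) \<le> ennreal (\<epsilon> * (1 / 2) ^ Suc n)" for n
    using q P' \<epsilon> by (intro Q(3)) auto
  then obtain C where C: "\<And>n. compact (C n)" "\<And>n. C n \<subseteq> interior (U (q n))"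
      "\<And>n. Q (q n) \<subseteq> line_union (interior (C n))"
      "\<And>n. emeasure lborel (line_union (C n) \<inter> {-R..R} \<times> UNIV - G) \<le> ennreal (\<epsilon> * (1 / 2) ^ Suc n)"
    by metis
  have "\<exists>n. U (q n) = U p \<and> p \<in> Q (q n)" if "p \<in> A" for p
    using sel[OF that] q by (metis imageE)
  then obtain N where N: "\<And>p. p \<in> A \<Longrightarrow> U (q (N p)) = U p" "\<And>p. p \<in> A \<Longrightarrow> p \<in> Q (q (N p))"
    by metis
  define S where "S n = line_union (C n) \<inter> {-R..R} \<times> UNIV - G" for n
  have S: "S n \<in> sets borel" for n
    unfolding S_def using compact_line_union[OF C(1)[of n], of R] G(1)
    by (auto simp: borel_compact)
  show ?thesis
  proof (intro exI[of _ "\<lambda>p. C (N p)"] exI[of _ "\<Union>n. S n"] conjI ballI)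
    fix p assume p: "p \<in> A"
    show "compact (C (N p))" "C (N p) \<subseteq> U p" "p \<in> line_union (interior (C (N p)))"
      using C(1,2,3)[of "N p"] N[OF p] interior_subset[of "U p"] by auto
    show "line_union (C (N p)) \<inter> {-R..R} \<times> UNIV - G \<subseteq> (\<Union>n. S n)"
      by (auto simp: S_def)
  next
    have "(\<lambda>p. C (N p)) ` A \<subseteq> range C"
      by blast
    then show "countable ((\<lambda>p. C (N p)) ` A)"
      by (rule countable_subset) simp
  next
    show "(\<Union>n. S n) \<in> sets lborel"
      using S by auto
    have "emeasure lborel (\<Union>n. S n) \<le> (\<Sum>n. emeasure lborel (S n))"
      using S by (intro emeasure_subadditive_countably) auto
    also have "\<dots> \<le> (\<Sum>n. ennreal (\<epsilon> * (1 / 2) ^ Suc n))"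
      using C(4) by (intro suminf_le) (auto simp: S_def)
    also have "\<dots> = ennreal \<epsilon>"
      using sums_mult[OF power_half_series, of \<epsilon>] \<epsilon> by (intro suminf_ennreal_eq) auto
    finally show "emeasure lborel (\<Union>n. S n) \<le> ennreal \<epsilon>" .
  qed
qed

section \<open>Davies's covering theorem by iterated refinement\<close>

theorem davies_line_covering:
  assumes W: "open W" "A \<subseteq> line_union W"
    and G: "\<And>n. open (G n)" "\<And>n. A \<subseteq> G n" "decseq G"
  obtains E where "E \<subseteq> W" "A \<subseteq> line_union E" "negligible (line_union E - (\<Inter>n. G n))"
proof -
  text \<open>
    A stage assigns to each point of \<open>A\<close> a set of lines covering it. The sets of
    successive stages are nested and compact, so each point keeps a line in the limit.
  \<close>
  define good where "good U \<longleftrightarrow> (\<forall>p\<in>A. p \<in> line_union (interior (U p)) \<and> U p \<subseteq> W) \<and> countable (U ` A)"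
    for U
  define next_stage where "next_stage n U U' \<longleftrightarrow> (\<forall>p\<in>A. compact (U' p) \<and> U' p \<subseteq> U p) \<and>
    (\<exists>T\<in>sets lborel. emeasure lborel T \<le> ennreal ((1 / 2) ^ n) \<and>
       (\<forall>p\<in>A. line_union (U' p) \<inter> {-real n..real n} \<times> UNIV - G n \<subseteq> T))" for n U U'
  have "\<exists>f. \<forall>n. good (f n) \<and> next_stage n (f n) (f (Suc n))"
  proof (rule dependent_nat_choice)
    have "(\<lambda>_. W) ` A \<subseteq> {W}"
      by auto
    then have "countable ((\<lambda>_. W) ` A)"
      by (rule countable_subset) simp
    then show "\<exists>U. good U"
      using W by (intro exI[of _ "\<lambda>_. W"]) (auto simp: good_def interior_open)
  next
    fix U n assume U: "good U"
    have cov: "p \<in> line_union (interior (U p))" if "p \<in> A" for p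
      using U that unfolding good_def by blast
    have count: "countable (U ` A)" and UW: "\<forall>p\<in>A. U p \<subseteq> W"
      using U unfolding good_def by blast+
    have pos: "0 < (1 / 2 :: real) ^ n"
      by simp
    from refine_cover[OF cov count G(1)[of n] G(2)[of n] pos of_nat_0_le_iff[of n]]
    obtain U' T where "\<forall>p\<in>A. compact (U' p) \<and> U' p \<subseteq> U p \<and> p \<in> line_union (interior (U' p))"
      "countable (U' ` A)" "T \<in> sets lborel" "emeasure lborel T \<le> ennreal ((1 / 2) ^ n)"
      "\<forall>p\<in>A. line_union (U' p) \<inter> {-real n..real n} \<times> UNIV - G n \<subseteq> T"
      by blast
    with UW show "\<exists>U'. good U' \<and> next_stage n U U'"
      unfolding good_def next_stage_def by (intro exI[of _ U']) blast
  qed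
  then obtain f where f: "\<And>n. good (f n)" "\<And>n. next_stage n (f n) (f (Suc n))"
    by metis
  \<comment> \<open>The shift by one drops the initial stage, which need not be compact.\<close>
  define K where "K n = f (Suc n)" for n
  have K: "compact (K n p)" "K (Suc n) p \<subseteq> K n p" "p \<in> line_union (K n p)" "K n p \<subseteq> W"
    if "p \<in> A" for n p
    using f(1)[of "Suc n"] f(2)[of n] f(2)[of "Suc n"] that
      line_union_mono[OF interior_subset[of "K n p"]]
    by (auto simp: K_def good_def next_stage_def)
  have "\<exists>T\<in>sets lborel. emeasure lborel T \<le> ennreal ((1 / 2) ^ n) \<and>
       (\<forall>p\<in>A. line_union (K n p) \<inter> {-real n..real n} \<times> UNIV - G n \<subseteq> T)" for n
    using f(2)[of n] by (auto simp: next_stage_def K_def)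
  then obtain T where T: "\<And>n. T n \<in> sets lborel" "\<And>n. emeasure lborel (T n) \<le> ennreal ((1 / 2) ^ n)"
    "\<And>n p. p \<in> A \<Longrightarrow> line_union (K n p) \<inter> {-real n..real n} \<times> UNIV - G n \<subseteq> T n"
    by metis
  define E where "E = (\<Inter>n. \<Union>p\<in>A. K n p)"
  show ?thesis
  proof (rule that[of E])
    show "E \<subseteq> W"
      using K(4) unfolding E_def by blast
    show "A \<subseteq> line_union E"
    proof safe
      fix \<alpha> s assume p: "(\<alpha>, s) \<in> A"
      \<comment> \<open>Only the lines of each stage that pass through the given point are kept.
        This closed condition preserves compactness, so one such line survives all stages.\<close>
      define B where "B n = K n (\<alpha>, s) \<inter> {e. shadow \<alpha> e = s}" for n
      have "closed {e. shadow \<alpha> e = s}"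
        by (intro closed_Collect_eq continuous_intros)
      then have "compact (B n)" for n
        using K(1)[OF p] by (auto simp: B_def)
      moreover have "B n \<noteq> {}" for n
        using K(3)[OF p, of n] by (auto simp: B_def mem_line_union)
      moreover have "B n \<subseteq> B m" if "m \<le> n" for m n
        using lift_Suc_antimono_le[of "\<lambda>n. K n (\<alpha>, s)", OF K(2)[OF p] that] by (auto simp: B_def)
      ultimately have "\<Inter>(range B) \<noteq> {}"
        by (intro compact_nest) auto
      then obtain e where "\<And>n. e \<in> B n"
        by auto
      then have "e \<in> E" "s = shadow \<alpha> e"
        using p unfolding E_def B_def by blast+
      then show "(\<alpha>, s) \<in> line_union E"
        unfolding mem_line_union by blast
    qed
    \<comment> \<open>A point outside some \<open>G i\<close> lies outside all later ones, and its
      abscissa is eventually in the window. It therefore lies in \<open>T n\<close> for all large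
      \<open>n\<close>, and such a tail intersection is null.\<close>
    define X where "X m = (\<Inter>n\<in>{m..}. T n)" for m
    have "X m \<in> null_sets lborel" for m
    proof -
      have "X m \<in> sets lborel"
        unfolding X_def using T(1) by (intro sets.countable_INT') auto
      moreover have "emeasure lborel (X m) \<le> 0"
      proof (rule LIMSEQ_le_const)
        have "(\<lambda>n. ennreal ((1 / 2) ^ n)) \<longlonglongrightarrow> ennreal 0"
          by (intro tendsto_ennrealI LIMSEQ_power_zero) auto
        then show "(\<lambda>n. ennreal ((1 / 2) ^ n)) \<longlonglongrightarrow> 0"
          by simp
        have "emeasure lborel (X m) \<le> ennreal ((1 / 2) ^ n)" if "m \<le> n" for n
        proof -
          have "emeasure lborel (X m) \<le> emeasure lborel (T n)"
            using that T(1) by (intro emeasure_mono) (auto simp: X_def)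
          then show ?thesis
            using T(2)[of n] by (rule order_trans)
        qed
        then show "\<exists>N. \<forall>n\<ge>N. emeasure lborel (X m) \<le> ennreal ((1 / 2) ^ n)"
          by blast
      qed
      ultimately show ?thesis
        by auto
    qed
    then have "(\<Union>m. X m) \<in> null_sets lborel"
      by (rule null_sets_UN)
    then have "negligible (\<Union>m. X m)"
      unfolding negligible_iff_null_sets by (rule null_sets_completionI)
    moreover have "line_union E - (\<Inter>n. G n) \<subseteq> (\<Union>m. X m)"
    proof
      fix p assume p: "p \<in> line_union E - (\<Inter>n. G n)"
      obtain \<alpha> s where \<alpha>s: "p = (\<alpha>, s)"
        by (cases p)
      with p obtain i where s: "(\<alpha>, s) \<in> line_union E" "(\<alpha>, s) \<notin> G i"
        by blast
      obtain j :: nat where j: "\<bar>\<alpha>\<bar> \<le> j"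
        using real_arch_simple by blast
      have "(\<alpha>, s) \<in> T n" if "max i j \<le> n" for n
      proof -
        obtain p where "p \<in> A" "(\<alpha>, s) \<in> line_union (K n p)"
          using s(1) unfolding mem_line_union E_def by blast
        moreover have "(\<alpha>, s) \<notin> G n"
          using s(2) decseqD[OF G(3), of i n] that by auto
        moreover have "\<alpha> \<in> {-real n..real n}"
          using j that by auto
        ultimately show ?thesis
          using T(3)[of p n] by blast
      qed
      then show "p \<in> (\<Union>m. X m)"
        unfolding X_def \<alpha>s by blast
    qed
    ultimately show "negligible (line_union E - (\<Inter>n. G n))"
      by (rule negligible_subset)
  qed
qed

section \<open>From lines to pinned distances\<close>

text \<open>Fubini for the Borel product measure; completeness turns the almost-everywhere statement
  on each fibre into membership in the null sets.\<close>

lemma AE_null_fibres: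
  fixes N :: "(real \<times> real) set"
  assumes "negligible N"
  shows "AE \<alpha> in lebesgue. Pair \<alpha> -` N \<in> null_sets lebesgue"
proof -
  have "AE p in lebesgue. p \<notin> N"
    using assms by (intro AE_not_in) (simp add: negligible_iff_null_sets)
  then have "AE p in lborel. p \<notin> N"
    by (simp add: AE_completion_iff)
  then have "AE p in lborel \<Otimes>\<^sub>M lborel. p \<notin> N"
    unfolding lborel_prod .
  from lborel_pair.AE_pair[OF this] have "AE \<alpha> in lborel. AE t in lborel. (\<alpha>, t) \<notin> N" .
  then have "AE \<alpha> in lborel. Pair \<alpha> -` N \<in> null_sets lebesgue"
  proof eventually_elim
    case (elim \<alpha>)
    then have "AE t in lebesgue. t \<notin> Pair \<alpha> -` N"
      by (auto intro: AE_completion)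
    then obtain M where "M \<in> null_sets lebesgue" "Pair \<alpha> -` N \<subseteq> M"
      by (auto simp: eventually_ae_filter)
    then show ?case
      using negligible_subset[of M] by (simp add: negligible_iff_null_sets)
  qed
  then show ?thesis
    by (rule AE_completion)
qed

theorem theorem5p7:
  fixes F :: "real \<Rightarrow> real set"
  assumes "\<And>\<alpha>. F \<alpha> \<subseteq> {0<..}"
    and "(\<Union>\<alpha>\<in>UNIV. {\<alpha>} \<times> F \<alpha>) \<in> sets (lebesgue :: (real \<times> real) measure)"
  shows "\<exists>E :: (real \<times> real) set. AE \<alpha> in lebesgue.
           F \<alpha> \<subseteq> pinned_distance_set (\<alpha>, 0) E \<and>
           pinned_distance_set (\<alpha>, 0) E - F \<alpha> \<in> null_sets lebesgue"
proof -
  define S where "S = (\<Union>\<alpha>\<in>UNIV. {\<alpha>} \<times> F \<alpha>)"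
  have "\<exists>H. open H \<and> S \<subseteq> H \<and> emeasure lebesgue (H - S) < ennreal ((1 / 2) ^ n)" for n
  proof -
    have "S \<in> sets lebesgue" "0 < (1 / 2 :: real) ^ n"
      using assms(2) by (auto simp: S_def)
    then obtain H where "open H" "S \<subseteq> H" "emeasure lebesgue (H - S) < ennreal ((1 / 2) ^ n)"
      by (rule sets_lebesgue_outer_open)
    then show ?thesis
      by blast
  qed
  then obtain H where H: "\<And>n. open (H n)" "\<And>n. S \<subseteq> H n"
      "\<And>n. emeasure lebesgue (H n - S) < ennreal ((1 / 2) ^ n)"
    by metis
  have HS: "negligible ((\<Inter>n. H n) - S)"
  proof -
    have *: "(\<Inter>n. H n) - S \<in> sets lebesgue" "H n - S \<in> sets lebesgue" for n
    proof -
      have "H n \<in> sets lebesgue" for n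
        using borel_open[OF H(1)[of n]] by simp
      then show "(\<Inter>n. H n) - S \<in> sets lebesgue" "H n - S \<in> sets lebesgue"
        using assms(2) unfolding S_def by (auto intro!: sets.Diff sets.countable_INT)
    qed
    have "emeasure lebesgue ((\<Inter>n. H n) - S) \<le> 0"
    proof (rule LIMSEQ_le_const)
      have "(\<lambda>n. ennreal ((1 / 2) ^ n)) \<longlonglongrightarrow> ennreal 0"
        by (intro tendsto_ennrealI LIMSEQ_power_zero) auto
      then show "(\<lambda>n. ennreal ((1 / 2) ^ n)) \<longlonglongrightarrow> 0"
        by simp
      have "emeasure lebesgue ((\<Inter>n. H n) - S) \<le> ennreal ((1 / 2) ^ n)" for n
      proof -
        have "emeasure lebesgue ((\<Inter>n. H n) - S) \<le> emeasure lebesgue (H n - S)"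
          using * by (intro emeasure_mono) auto
        then show ?thesis
          using H(3)[of n] by (meson less_imp_le order_trans)
      qed
      then show "\<exists>N. \<forall>n\<ge>N. emeasure lebesgue ((\<Inter>n. H n) - S) \<le> ennreal ((1 / 2) ^ n)"
        by blast
    qed
    then show ?thesis
      using *(1) by (auto simp: negligible_iff_null_sets)
  qed
  \<comment> \<open>Inverse of the change of variables from \<open>(\<alpha>, t)\<close> to
    \<open>(\<alpha>, t\<^sup>2 - \<alpha>\<^sup>2)\<close> for positive \<open>t\<close>. It is
    continuous on the whole plane because \<open>sqrt\<close> is extended to negative arguments as
    an odd function.\<close>
  define \<phi> :: "real \<times> real \<Rightarrow> real \<times> real" where "\<phi> p = (fst p, sqrt (snd p + (fst p)\<^sup>2))" for p
  define A where "A = (\<lambda>p. (fst p, (snd p)\<^sup>2 - (fst p)\<^sup>2)) ` S"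
  \<comment> \<open>With \<open>u = - 2 x\<close> and \<open>v = x\<^sup>2 + y\<^sup>2\<close> this
    says that \<open>y\<close> is nonzero, that is, the line stays strictly above the
    parabola.\<close>
  define W where "W = {e :: real \<times> real. (fst e)\<^sup>2 / 4 < snd e}"
  \<comment> \<open>Finite intersections make the sequence decreasing.\<close>
  define G where "G n = (\<Inter>k\<le>n. \<phi> -` H k)" for n
  have A_H: "\<phi> p \<in> S" if "p \<in> A" for p
    using that assms(1) by (fastforce simp: A_def \<phi>_def S_def)
  obtain E where E: "E \<subseteq> W" "A \<subseteq> line_union E" "negligible (line_union E - (\<Inter>n. G n))"
  proof (rule davies_line_covering)
    show "open W"
      unfolding W_def by (intro open_Collect_less continuous_intros) auto
    show "A \<subseteq> line_union W"
    proof
      fix p assume "p \<in> A"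
      then obtain \<alpha> t where p: "p = (\<alpha>, t\<^sup>2 - \<alpha>\<^sup>2)" "t \<in> F \<alpha>"
        by (auto simp: A_def S_def)
      then have "0 < t"
        using assms(1) by auto
      \<comment> \<open>The dual of the point \<open>(\<alpha>, t)\<close>, vertically above the pin
        at distance \<open>t\<close>.\<close>
      then have "(-2 * \<alpha>, t\<^sup>2 + \<alpha>\<^sup>2) \<in> W"
        by (simp add: W_def power_mult_distrib)
      moreover have "t\<^sup>2 - \<alpha>\<^sup>2 = shadow \<alpha> (-2 * \<alpha>, t\<^sup>2 + \<alpha>\<^sup>2)"
        by (simp add: shadow_def power2_eq_square)
      ultimately show "p \<in> line_union W"
        unfolding p mem_line_union by blast
    qed
    show "open (G n)" for n
      unfolding G_def \<phi>_def by (intro open_INT ballI open_vimage H continuous_intros) auto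
    show "A \<subseteq> G n" for n
    proof
      fix p assume "p \<in> A"
      then have "\<phi> p \<in> H k" for k
        using A_H H(2) by blast
      then show "p \<in> G n"
        by (simp add: G_def)
    qed
    show "decseq G"
      by (auto simp: decseq_def G_def)
  qed
  have pos: "0 < s + \<alpha>\<^sup>2" if s: "(\<alpha>, s) \<in> line_union E" for \<alpha> s
  proof -
    obtain u v where e: "(u, v) \<in> E" "s = shadow \<alpha> (u, v)"
      using s unfolding mem_line_union by force
    then have "s = v + \<alpha> * u" "u\<^sup>2 / 4 < v"
      using E(1) by (auto simp: shadow_def W_def)
    moreover have "v + \<alpha> * u + \<alpha>\<^sup>2 = (v - u\<^sup>2 / 4) + (\<alpha> + u / 2)\<^sup>2"
      by (simp add: power2_eq_square algebra_simps)
    ultimately show ?thesis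
      using zero_le_power2[of "\<alpha> + u / 2"] by linarith
  qed
  \<comment> \<open>Back from lines to points of the upper half plane.\<close>
  define E' where "E' = (\<lambda>e. (- fst e / 2, sqrt (snd e - (fst e)\<^sup>2 / 4))) ` E"
  have dist_eq: "dist (- fst e / 2, sqrt (snd e - (fst e)\<^sup>2 / 4)) (\<alpha>, 0) = sqrt (shadow \<alpha> e + \<alpha>\<^sup>2)"
    if "e \<in> E" for e \<alpha>
  proof -
    have "0 \<le> snd e - (fst e)\<^sup>2 / 4"
      using that E(1) by (auto simp: W_def)
    moreover have "(- fst e / 2 - \<alpha>)\<^sup>2 + (snd e - (fst e)\<^sup>2 / 4) = shadow \<alpha> e + \<alpha>\<^sup>2"
      by (simp add: shadow_def power2_eq_square algebra_simps)
    ultimately show ?thesis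
      by (simp add: dist_Pair_Pair dist_real_def)
  qed
  have pinned: "pinned_distance_set (\<alpha>, 0) E' = Pair \<alpha> -` \<phi> ` line_union E" for \<alpha>
  proof -
    have "pinned_distance_set (\<alpha>, 0) E' = (\<lambda>x. dist x (\<alpha>, 0)) ` E'"
      unfolding pinned_distance_set_def by blast
    also have "\<dots> = (\<lambda>e. sqrt (shadow \<alpha> e + \<alpha>\<^sup>2)) ` E"
      unfolding E'_def image_image by (intro image_cong refl dist_eq)
    also have "\<dots> = Pair \<alpha> -` \<phi> ` line_union E"
    proof (intro set_eqI)
      fix t
      show "t \<in> (\<lambda>e. sqrt (shadow \<alpha> e + \<alpha>\<^sup>2)) ` E \<longleftrightarrow> t \<in> Pair \<alpha> -` \<phi> ` line_union E"
        unfolding line_union_def \<phi>_def vimage_def image_iff mem_Collect_eq Bex_def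
        by (metis fst_conv prod.inject snd_conv)
    qed
    finally show ?thesis .
  qed
  \<comment> \<open>By \<open>pos\<close>, \<phi> is differentiable on the union of the lines and so
    maps the null excess to a null set; the remaining image lies in the intersection of the
    \<open>H n\<close>.\<close>
  have "negligible (\<phi> ` line_union E - S)"
  proof (rule negligible_subset)
    have "\<phi> differentiable_on (line_union E - (\<Inter>n. G n))"
    proof (rule differentiable_at_imp_differentiable_on)
      fix p assume "p \<in> line_union E - (\<Inter>n. G n)"
      then have "0 < snd p + (fst p)\<^sup>2"
        using pos[of "fst p" "snd p"] by auto
      then have "(\<phi> has_derivative (\<lambda>h. (fst h, (snd h + 2 * fst p * fst h) * (inverse (sqrt (snd p + (fst p)\<^sup>2)) / 2)))) (at p)"
        unfolding \<phi>_def by (auto intro!: derivative_eq_intros simp: algebra_simps)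
      then show "\<phi> differentiable (at p)"
        by (rule differentiableI)
    qed
    then have "negligible (\<phi> ` (line_union E - (\<Inter>n. G n)))"
      by (intro negligible_differentiable_image_negligible E(3)) auto
    then show "negligible (\<phi> ` (line_union E - (\<Inter>n. G n)) \<union> ((\<Inter>n. H n) - S))"
      using HS by (rule negligible_Un)
    show "\<phi> ` line_union E - S \<subseteq> \<phi> ` (line_union E - (\<Inter>n. G n)) \<union> ((\<Inter>n. H n) - S)"
      unfolding G_def by blast
  qed
  from AE_null_fibres[OF this]
  have "AE \<alpha> in lebesgue. F \<alpha> \<subseteq> pinned_distance_set (\<alpha>, 0) E' \<and>
           pinned_distance_set (\<alpha>, 0) E' - F \<alpha> \<in> null_sets lebesgue"
  proof eventually_elim
    case (elim \<alpha>)
    have "Pair \<alpha> -` (\<phi> ` line_union E - S) = pinned_distance_set (\<alpha>, 0) E' - F \<alpha>"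
      unfolding pinned by (auto simp: S_def)
    moreover have "F \<alpha> \<subseteq> pinned_distance_set (\<alpha>, 0) E'"
    proof
      fix t assume t: "t \<in> F \<alpha>"
      then have "(\<alpha>, t\<^sup>2 - \<alpha>\<^sup>2) \<in> A"
        by (force simp: A_def S_def image_iff)
      moreover have "\<phi> (\<alpha>, t\<^sup>2 - \<alpha>\<^sup>2) = (\<alpha>, t)"
        using t assms(1) by (force simp: \<phi>_def)
      ultimately show "t \<in> pinned_distance_set (\<alpha>, 0) E'"
        unfolding pinned using E(2) by (metis image_eqI subsetD vimageI)
    qed
    ultimately show ?case
      using elim by simp
  qed
  then show ?thesis
    by blast
qed

end
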